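(* Let $a,b$ be non-zero complex numbers with $|a|^2+|b|^2=1$, and consider the product states $|00\rangle_{AB}$ and $a|10\rangle_{AB}+b|11\rangle_{AB}$. The entangled states in $\mathbb{C}^2\otimes\mathbb{C}^2$ orthogonal to both of them are exactly the states characterized by two non-zero complex numbers $c,d$ with $|c|^2+|d|^2=1$ through the Schmidt decomposition $$|\mathrm{ppE}\rangle_{AB}=\sum_{j=0}^1\nu_j\left(\frac{|x_j\rangle_A}{\||x_j\rangle\|}\right)\otimes\left(\frac{|y_j^*\rangle_B}{\||y_j\rangle\|}\right),$$ where $$\nu_j=\left(\frac{1+(-1)^j\sqrt{1-4|bcd|^2}}{2}\right)^{1/2},\quad |x_j\rangle=\begin{bmatrix}c(\nu_j^2-|bd|^2)\\-a^*d\,\nu_j^2\end{bmatrix},\quad |y_j\rangle=\begin{bmatrix}-a^*b|d|^2\\ \nu_j^2-|bd|^2\end{bmatrix}.$$ In particular $|x_0\rangle\perp|x_1\rangle$ and $|y_0\rangle\perp|y_1\rangle$.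
   Context: $|0\rangle,|1\rangle$ is the standard basis of $\mathbb{C}^2$, $|jk\rangle_{AB}=|j\rangle_A\otimes|k\rangle_B$, column vectors are with respect to the standard basis, $^*$ on scalars is complex conjugation, and $|y^*\rangle$ is the entrywise complex conjugate of $|y\rangle$. A state is a unit vector; a state in $\mathbb{C}^2\otimes\mathbb{C}^2$ is a product state if it equals $|u\rangle\otimes|v\rangle$, and entangled otherwise. A Schmidt decomposition of a state is an expression $\sum_j\lambda_j|u_j\rangle\otimes|v_j\rangle$ with $\lambda_j\ge 0$ (the Schmidt coefficients) and $\{|u_j\rangle\}$, $\{|v_j\rangle\}$ orthonormal families in $\mathbb{C}^2$. *)

theory Defs
  imports "HOL-Analysis.Analysis"
begin

(* Conjugate-linear in the first argument.  The library's inner and orthogonal on complex ^ 'n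
   only see the real part of this form; norm, on the other hand, is the norm it induces. *)
definition cinner :: "complex ^ 'n \<Rightarrow> complex ^ 'n \<Rightarrow> complex" where
  "cinner u v = (\<Sum>i\<in>UNIV. cnj (u $ i) * v $ i)"

definition corthogonal :: "complex ^ 'n \<Rightarrow> complex ^ 'n \<Rightarrow> bool"  (infix "\<bottom>" 50) where
  "u \<bottom> v \<longleftrightarrow> cinner u v = 0"

definition vec_cnj :: "complex ^ 'n \<Rightarrow> complex ^ 'n" where
  "vec_cnj v = (\<chi> i. cnj (v $ i))"

(* C^2 \<otimes> C^2 is complex ^ (2 \<times> 2), with coordinates with respect to the product basis. *)
definition tensor :: "complex ^ 'm \<Rightarrow> complex ^ 'n \<Rightarrow> complex ^ ('m \<times> 'n)"  (infixr "\<otimes>" 75) where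
  "u \<otimes> v = (\<chi> p. u $ fst p * v $ snd p)"

definition ket0 :: "complex ^ 2" where "ket0 = vector [1, 0]"
definition ket1 :: "complex ^ 2" where "ket1 = vector [0, 1]"

definition state :: "complex ^ 'n \<Rightarrow> bool" where
  "state \<psi> \<longleftrightarrow> norm \<psi> = 1"

definition product_state :: "complex ^ (2 \<times> 2) \<Rightarrow> bool" where
  "product_state \<psi> \<longleftrightarrow> state \<psi> \<and> (\<exists>u v :: complex ^ 2. \<psi> = u \<otimes> v)"

definition entangled_state :: "complex ^ (2 \<times> 2) \<Rightarrow> bool" where
  "entangled_state \<psi> \<longleftrightarrow> state \<psi> \<and> \<not> product_state \<psi>"

definition orthonormal_family :: "'i set \<Rightarrow> ('i \<Rightarrow> complex ^ 'n) \<Rightarrow> bool" where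
  "orthonormal_family J u \<longleftrightarrow> (\<forall>i\<in>J. \<forall>j\<in>J. cinner (u i) (u j) = (if i = j then 1 else 0))"

definition schmidt_decomposition ::
  "complex ^ (2 \<times> 2) \<Rightarrow> 'i set \<Rightarrow> ('i \<Rightarrow> real) \<Rightarrow> ('i \<Rightarrow> complex ^ 2) \<Rightarrow> ('i \<Rightarrow> complex ^ 2) \<Rightarrow> bool" where
  "schmidt_decomposition \<psi> J \<mu> u v \<longleftrightarrow>
     finite J \<and> (\<forall>j\<in>J. 0 \<le> \<mu> j) \<and> orthonormal_family J u \<and> orthonormal_family J v \<and>
     \<psi> = (\<Sum>j\<in>J. \<mu> j *\<^sub>R (u j \<otimes> v j))"

definition schmidt_coeff :: "complex \<Rightarrow> complex \<Rightarrow> complex \<Rightarrow> nat \<Rightarrow> real" where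
  "schmidt_coeff b c d j = sqrt ((1 + (-1) ^ j * sqrt (1 - 4 * (cmod (b * c * d))\<^sup>2)) / 2)"

definition xvec :: "complex \<Rightarrow> complex \<Rightarrow> complex \<Rightarrow> complex \<Rightarrow> nat \<Rightarrow> complex ^ 2" where
  "xvec a b c d j = vector
     [c * of_real ((schmidt_coeff b c d j)\<^sup>2 - (cmod (b * d))\<^sup>2),
      - (cnj a * d * of_real ((schmidt_coeff b c d j)\<^sup>2))]"

definition yvec :: "complex \<Rightarrow> complex \<Rightarrow> complex \<Rightarrow> complex \<Rightarrow> nat \<Rightarrow> complex ^ 2" where
  "yvec a b c d j = vector
     [- (cnj a * b * of_real ((cmod d)\<^sup>2)),
      of_real ((schmidt_coeff b c d j)\<^sup>2 - (cmod (b * d))\<^sup>2)]"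

definition ppE :: "complex \<Rightarrow> complex \<Rightarrow> complex \<Rightarrow> complex \<Rightarrow> complex ^ (2 \<times> 2)" where
  "ppE a b c d = (\<Sum>j\<in>{0..1}. schmidt_coeff b c d j *\<^sub>R
     ((xvec a b c d j /\<^sub>R norm (xvec a b c d j)) \<otimes>
      (vec_cnj (yvec a b c d j) /\<^sub>R norm (yvec a b c d j))))"

end

theory Submission imports Defs begin

text \<open>The states orthogonal to both product states are
  $\psi = c|01\rangle + d|1\rangle \otimes (b^*|0\rangle - a^*|1\rangle)$ with
  $|c|^2 + |d|^2 = 1$; the coefficient matrix of $\psi$ has determinant $-b^*cd$, so $\psi$ is
  entangled exactly when $c, d \neq 0$. The numbers $p = \nu_0^2$ and $q = \nu_1^2$ are the roots
  of $t^2 - t + |bcd|^2$. With $A = |ad|^2$ and $B = |bd|^2$ the discriminant is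
  $(1 - 2B)^2 + 4AB > 0$, so $p \neq q$. Moreover $(p - B)(q - B) = -AB$, whence
  $\|y_0\|^2 = (p - B)(p - q)$ and $\|x_0\| = \nu_0\|y_0\|$, and likewise for $j = 1$ with $p$ and
  $q$ exchanged. So the $j$-th Schmidt term is $x_j y_j^\dagger / \|y_j\|^2$, and the two
  terms add up to $\psi$ entry by entry.\<close>

section \<open>Coordinates, norms and the complex inner product\<close>

lemma UNIV_2_times_2: "(UNIV :: (2 \<times> 2) set) = {(1, 1), (1, 2), (2, 1), (2, 2)}"
proof -
  have "z \<in> {(1, 1), (1, 2), (2, 1), (2, 2)}" for z :: "2 \<times> 2"
    using exhaust_2[of "fst z"] exhaust_2[of "snd z"] by (cases z) auto
  then show ?thesis by blast
qed

lemma sum_2_times_2: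
  "sum f (UNIV :: (2 \<times> 2) set) = f (1, 1) + f (1, 2) + f (2, 1) + f (2, 2)"
  by (simp add: UNIV_2_times_2 add.assoc)

lemma vec_eq_iff_2_times_2:
  fixes u v :: "'a ^ (2 \<times> 2)"
  shows "u = v \<longleftrightarrow> u $ (1, 1) = v $ (1, 1) \<and> u $ (1, 2) = v $ (1, 2) \<and>
    u $ (2, 1) = v $ (2, 1) \<and> u $ (2, 2) = v $ (2, 2)"
proof -
  have "u = v \<longleftrightarrow> (\<forall>i \<in> (UNIV :: (2 \<times> 2) set). u $ i = v $ i)"
    by (simp add: vec_eq_iff)
  then show ?thesis by (simp only: UNIV_2_times_2) simp
qed

lemma norm_squared_vec_complex:
  fixes u :: "complex ^ 'n"
  shows "(norm u)\<^sup>2 = (\<Sum>i\<in>UNIV. (cmod (u $ i))\<^sup>2)"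
  by (simp add: norm_vec_def L2_set_def sum_nonneg)

lemma cinner_self: "cinner u u = of_real ((norm u)\<^sup>2)"
  by (simp only: cinner_def norm_squared_vec_complex of_real_sum complex_norm_square mult.commute)

lemma cinner_commute: "cinner v u = cnj (cinner u v)"
  by (simp add: cinner_def mult.commute)

lemma cinner_vec_cnj: "cinner (vec_cnj u) (vec_cnj v) = cnj (cinner u v)"
  by (simp add: cinner_def vec_cnj_def)

lemma norm_vec_cnj: "norm (vec_cnj v) = norm v"
  by (simp add: norm_vec_def vec_cnj_def)

lemma cinner_scaleR: "cinner (r *\<^sub>R u) (s *\<^sub>R v) = of_real (r * s) * cinner u v"
  by (simp add: cinner_def sum_distrib_left scaleR_conv_of_real[where 'a = complex] mult_ac)

lemma state_iff_norm_squared: "state \<psi> \<longleftrightarrow> (norm \<psi>)\<^sup>2 = 1"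
  unfolding state_def by (metis norm_ge_zero one_power2 power2_eq_imp_eq zero_le_one)

text \<open>One off-diagonal product suffices, since the other one is its conjugate.\<close>

lemma orthonormal_family_normalized:
  fixes v :: "nat \<Rightarrow> complex ^ 'n"
  assumes "v 0 \<noteq> 0" and "v 1 \<noteq> 0" and "cinner (v 0) (v 1) = 0"
  shows "orthonormal_family {0..1} (\<lambda>j. v j /\<^sub>R norm (v j))"
proof -
  have I: "{0..1::nat} = {0, 1}" by auto
  have "cinner (v 1) (v 0) = 0"
    unfolding cinner_commute[of "v 1" "v 0"] assms(3) by simp
  with assms show ?thesis
    by (simp add: orthonormal_family_def I cinner_self cinner_scaleR power2_eq_square field_simps del: One_nat_def)
qed

section \<open>The orthogonal complement of the two product states\<close>

definition pp_state :: "complex \<Rightarrow> complex \<Rightarrow> complex \<Rightarrow> complex \<Rightarrow> complex ^ (2 \<times> 2)" where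
  "pp_state a b c d =
     c *s (ket0 \<otimes> ket1) + d *s (ket1 \<otimes> (cnj b *s ket0 - cnj a *s ket1))"

lemma pp_state_nth [simp]:
  "pp_state a b c d $ (1, 1) = 0"
  "pp_state a b c d $ (1, 2) = c"
  "pp_state a b c d $ (2, 1) = d * cnj b"
  "pp_state a b c d $ (2, 2) = - (d * cnj a)"
  by (simp_all add: pp_state_def tensor_def ket0_def ket1_def)

lemma norm_pp_state:
  assumes "(cmod a)\<^sup>2 + (cmod b)\<^sup>2 = 1"
  shows "(norm (pp_state a b c d))\<^sup>2 = (cmod c)\<^sup>2 + (cmod d)\<^sup>2"
proof -
  have "(norm (pp_state a b c d))\<^sup>2 =
      (cmod c)\<^sup>2 + (cmod d)\<^sup>2 * ((cmod a)\<^sup>2 + (cmod b)\<^sup>2)"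
    by (simp add: norm_squared_vec_complex sum_2_times_2 norm_mult power_mult_distrib
        algebra_simps)
  with assms show ?thesis by simp
qed

text \<open>The first condition kills the (1, 1) entry. The second makes the second row of the
  coefficient matrix orthogonal to (a, b), hence a multiple of (\<open>cnj b\<close>,
  \<open>- cnj a\<close>).\<close>

lemma orthogonal_both_iff:
  assumes "b \<noteq> 0"
  shows "\<psi> \<bottom> ket0 \<otimes> ket0 \<and> \<psi> \<bottom> a *s (ket1 \<otimes> ket0) + b *s (ket1 \<otimes> ket1) \<longleftrightarrow>
    (\<exists>c d. \<psi> = pp_state a b c d)"
proof -
  have 1: "\<psi> \<bottom> ket0 \<otimes> ket0 \<longleftrightarrow> \<psi> $ (1, 1) = 0"
    by (simp add: corthogonal_def cinner_def sum_2_times_2 tensor_def ket0_def)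
  \<comment> \<open>\<open>cinner\<close> conjugates the entries of \<psi>; the outer
    \<open>cnj\<close> undoes this and gives a linear equation in the entries themselves.\<close>
  have "\<psi> \<bottom> a *s (ket1 \<otimes> ket0) + b *s (ket1 \<otimes> ket1) \<longleftrightarrow>
      cnj (cnj (\<psi> $ (2, 1)) * a + cnj (\<psi> $ (2, 2)) * b) = 0"
    by (simp add: corthogonal_def cinner_def sum_2_times_2 tensor_def ket0_def ket1_def
        del: complex_cnj_add complex_cnj_mult)
  then have 2: "\<psi> \<bottom> a *s (ket1 \<otimes> ket0) + b *s (ket1 \<otimes> ket1) \<longleftrightarrow>
      \<psi> $ (2, 1) * cnj a + \<psi> $ (2, 2) * cnj b = 0"
    by simp
  show ?thesis
  proof
    assume "\<psi> \<bottom> ket0 \<otimes> ket0 \<and> \<psi> \<bottom> a *s (ket1 \<otimes> ket0) + b *s (ket1 \<otimes> ket1)"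
    \<comment> \<open>The (1, 2) entry is c itself, and the (2, 1) entry \<open>d * cnj b\<close>
      yields d because b is non-zero.\<close>
    then have "\<psi> = pp_state a b (\<psi> $ (1, 2)) (\<psi> $ (2, 1) / cnj b)"
      using assms unfolding 1 2
      by (auto simp: vec_eq_iff_2_times_2 field_simps add_eq_0_iff)
    then show "\<exists>c d. \<psi> = pp_state a b c d" by blast
  next
    assume "\<exists>c d. \<psi> = pp_state a b c d"
    then show "\<psi> \<bottom> ket0 \<otimes> ket0 \<and> \<psi> \<bottom> a *s (ket1 \<otimes> ket0) + b *s (ket1 \<otimes> ket1)"
      unfolding 1 2 by auto
  qed
qed

lemma entangled_pp_state_iff:
  assumes "b \<noteq> 0" and "(cmod a)\<^sup>2 + (cmod b)\<^sup>2 = 1"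
  shows "entangled_state (pp_state a b c d) \<longleftrightarrow>
    c \<noteq> 0 \<and> d \<noteq> 0 \<and> (cmod c)\<^sup>2 + (cmod d)\<^sup>2 = 1"
proof -
  have st: "state (pp_state a b c d) \<longleftrightarrow> (cmod c)\<^sup>2 + (cmod d)\<^sup>2 = 1"
    unfolding state_iff_norm_squared norm_pp_state[OF assms(2)] ..
  have "(\<exists>u v :: complex ^ 2. pp_state a b c d = u \<otimes> v) \<longleftrightarrow> c = 0 \<or> d = 0"
  proof
    assume "\<exists>u v :: complex ^ 2. pp_state a b c d = u \<otimes> v"
    then obtain u v :: "complex ^ 2" where uv: "pp_state a b c d = u \<otimes> v" by blast
    \<comment> \<open>The coefficient matrix of a product vector has rank at most one, so its
      determinant vanishes; for \<open>pp_state\<close> this reads 0 = c * (d *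
      \<open>cnj b\<close>).\<close>
    have "(u \<otimes> v) $ (1, 1) * (u \<otimes> v) $ (2, 2) = (u \<otimes> v) $ (1, 2) * (u \<otimes> v) $ (2, 1)"
      by (simp add: tensor_def)
    then show "c = 0 \<or> d = 0"
      unfolding uv[symmetric] using assms(1) by simp
  next
    assume "c = 0 \<or> d = 0"
    moreover have "pp_state a b 0 d = (d *s ket1) \<otimes> (cnj b *s ket0 - cnj a *s ket1)"
      by (simp add: vec_eq_iff_2_times_2 tensor_def ket0_def ket1_def)
    moreover have "pp_state a b c 0 = (c *s ket0) \<otimes> ket1"
      by (simp add: vec_eq_iff_2_times_2 tensor_def ket0_def ket1_def)
    ultimately show "\<exists>u v :: complex ^ 2. pp_state a b c d = u \<otimes> v" by blast
  qed
  then show ?thesis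
    by (auto simp: entangled_state_def product_state_def st)
qed

section \<open>The squared Schmidt coefficients as roots of a quadratic\<close>

locale pp_params =
  fixes a b c d :: complex
  assumes nonzero: "a \<noteq> 0" "b \<noteq> 0" "c \<noteq> 0" "d \<noteq> 0"
    and ab: "(cmod a)\<^sup>2 + (cmod b)\<^sup>2 = 1"
    and cd: "(cmod c)\<^sup>2 + (cmod d)\<^sup>2 = 1"
begin

definition A :: real where "A = (cmod (a * d))\<^sup>2"
definition B :: real where "B = (cmod (b * d))\<^sup>2"
definition p :: real where "p = (schmidt_coeff b c d 0)\<^sup>2"
definition q :: real where "q = (schmidt_coeff b c d 1)\<^sup>2"

lemma A_pos: "A > 0" and B_pos: "B > 0"
  using nonzero by (simp_all add: A_def B_def)

lemma A_plus_B: "A + B = (cmod d)\<^sup>2"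
proof -
  have "A + B = (cmod d)\<^sup>2 * ((cmod a)\<^sup>2 + (cmod b)\<^sup>2)"
    by (simp add: A_def B_def norm_mult power_mult_distrib algebra_simps)
  with ab show ?thesis by simp
qed

text \<open>Eliminates c, so that the later real identities become polynomial in \<open>A\<close>,
  \<open>B\<close>, \<open>p\<close> and \<open>q\<close>.\<close>

lemma C_eq: "(cmod c)\<^sup>2 = 1 - A - B"
  using A_plus_B cd by simp

lemma bcd_eq: "(cmod (b * c * d))\<^sup>2 = B * (1 - A - B)"
  unfolding C_eq[symmetric] by (simp add: B_def norm_mult power_mult_distrib)

lemma discriminant_pos: "1 - 4 * (cmod (b * c * d))\<^sup>2 > 0"
proof -
  \<comment> \<open>The product \<open>A * B\<close> keeps the discriminant strictly positive even
    when \<open>B\<close> is 1/2.\<close>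
  have "(1 - 2 * B)\<^sup>2 + 4 * (A * B) > 0"
    using A_pos B_pos by (simp add: add_nonneg_pos)
  then show ?thesis
    unfolding bcd_eq by (simp add: power2_eq_square algebra_simps)
qed

lemma discriminant_le_1: "sqrt (1 - 4 * (cmod (b * c * d))\<^sup>2) \<le> 1"
  by simp

text \<open>As the inner root lies between 0 and 1, the outer radicand is nonnegative for both
  signs, and squaring removes the outer root.\<close>

lemma p_eq: "p = (1 + sqrt (1 - 4 * (cmod (b * c * d))\<^sup>2)) / 2"
  and q_eq: "q = (1 - sqrt (1 - 4 * (cmod (b * c * d))\<^sup>2)) / 2"
  using discriminant_pos discriminant_le_1 by (simp_all add: p_def q_def schmidt_coeff_def)

lemma p_neq_q: "p \<noteq> q"
  using discriminant_pos unfolding p_eq q_eq by simp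

lemma p_plus_q: "p + q = 1"
  unfolding p_eq q_eq by (simp add: field_simps)

lemma p_times_q: "p * q = B * (1 - A - B)"
proof -
  have "(sqrt (1 - 4 * (cmod (b * c * d))\<^sup>2))\<^sup>2 = 1 - 4 * (cmod (b * c * d))\<^sup>2"
    using discriminant_pos by simp
  then have "p * q = (cmod (b * c * d))\<^sup>2"
    unfolding p_eq q_eq by (simp add: field_simps power2_eq_square)
  then show ?thesis using bcd_eq by simp
qed

text \<open>The left side is the quadratic t^2 - t + |bcd|^2 with roots \<open>p\<close> and
  \<open>q\<close>, evaluated at t = \<open>B\<close>.\<close>

lemma shifted_prod: "(p - B) * (q - B) = - (A * B)"
  using p_plus_q p_times_q by algebra

lemma p_neq_B: "p - B \<noteq> 0" and q_neq_B: "q - B \<noteq> 0"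
  using shifted_prod A_pos B_pos by auto

section \<open>Norms and orthogonality of the Schmidt vectors\<close>

lemma xvec_nth:
  "xvec a b c d 0 $ 1 = c * of_real (p - B)" "xvec a b c d 0 $ 2 = - (cnj a * d * of_real p)"
  "xvec a b c d 1 $ 1 = c * of_real (q - B)" "xvec a b c d 1 $ 2 = - (cnj a * d * of_real q)"
  by (simp_all add: xvec_def p_def q_def B_def)

lemma yvec_nth:
  "yvec a b c d 0 $ 1 = - (cnj a * b * of_real ((cmod d)\<^sup>2))"
  "yvec a b c d 0 $ 2 = of_real (p - B)"
  "yvec a b c d 1 $ 1 = - (cnj a * b * of_real ((cmod d)\<^sup>2))"
  "yvec a b c d 1 $ 2 = of_real (q - B)"
  by (simp_all add: yvec_def p_def q_def B_def)

lemma norm_yvec_first: "(cmod (cnj a * b * of_real ((cmod d)\<^sup>2)))\<^sup>2 = A * B"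
  by (simp add: A_def B_def norm_mult power_mult_distrib power2_eq_square)

text \<open>The first coordinate contributes \<open>A * B\<close>, which by
  \<open>shifted_prod\<close> is \<open>- ((p - B) * (q - B))\<close>; then a common factor
  \<open>p - B\<close> (respectively \<open>q - B\<close>) comes out of the sum.\<close>

lemma norm_yvec:
  "(norm (yvec a b c d 0))\<^sup>2 = (p - B) * (p - q)"
  "(norm (yvec a b c d 1))\<^sup>2 = (q - B) * (q - p)"
proof -
  have "(norm (yvec a b c d 0))\<^sup>2 = A * B + (p - B)\<^sup>2"
    unfolding norm_squared_vec_complex sum_2 yvec_nth norm_minus_cancel norm_yvec_first
    by (simp only: norm_of_real power2_abs)
  then show "(norm (yvec a b c d 0))\<^sup>2 = (p - B) * (p - q)"
    using shifted_prod by algebra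
  have "(norm (yvec a b c d 1))\<^sup>2 = A * B + (q - B)\<^sup>2"
    unfolding norm_squared_vec_complex sum_2 yvec_nth norm_minus_cancel norm_yvec_first
    by (simp only: norm_of_real power2_abs)
  then show "(norm (yvec a b c d 1))\<^sup>2 = (q - B) * (q - p)"
    using shifted_prod by algebra
qed

lemma norm_xvec_aux:
  "(cmod (c * of_real r))\<^sup>2 = (1 - A - B) * r\<^sup>2"
  "(cmod (cnj a * d * of_real r))\<^sup>2 = A * r\<^sup>2"
  unfolding C_eq[symmetric] by (simp_all add: A_def norm_mult power_mult_distrib)

text \<open>The ratio of the squared norms is exactly the squared Schmidt coefficient, which is what
  later cancels the coefficient from each term.\<close>

lemma norm_xvec_squared:
  "(norm (xvec a b c d 0))\<^sup>2 = p * (norm (yvec a b c d 0))\<^sup>2"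
  "(norm (xvec a b c d 1))\<^sup>2 = q * (norm (yvec a b c d 1))\<^sup>2"
proof -
  have "(norm (xvec a b c d 0))\<^sup>2 = (1 - A - B) * (p - B)\<^sup>2 + A * p\<^sup>2"
    unfolding norm_squared_vec_complex sum_2 xvec_nth norm_minus_cancel norm_xvec_aux ..
  also have "\<dots> = p * ((p - B) * (p - q))"
    \<comment> \<open>The two sides differ by a multiple of
      \<open>(p - B) * (q - B) + A * B\<close>, which is zero.\<close>
    using p_plus_q p_times_q by algebra
  finally show "(norm (xvec a b c d 0))\<^sup>2 = p * (norm (yvec a b c d 0))\<^sup>2"
    by (simp only: norm_yvec)
  have "(norm (xvec a b c d 1))\<^sup>2 = (1 - A - B) * (q - B)\<^sup>2 + A * q\<^sup>2"
    unfolding norm_squared_vec_complex sum_2 xvec_nth norm_minus_cancel norm_xvec_aux ..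
  also have "\<dots> = q * ((q - B) * (q - p))"
    using p_plus_q p_times_q by algebra
  finally show "(norm (xvec a b c d 1))\<^sup>2 = q * (norm (yvec a b c d 1))\<^sup>2"
    by (simp only: norm_yvec)
qed

lemma schmidt_coeff_nonneg: "0 \<le> schmidt_coeff b c d j"
proof -
  have "\<bar>(-1) ^ j * sqrt (1 - 4 * (cmod (b * c * d))\<^sup>2)\<bar> \<le> 1"
    using discriminant_pos discriminant_le_1 by (simp add: abs_mult power_abs)
  then show ?thesis by (simp add: schmidt_coeff_def)
qed

lemma norm_xvec:
  assumes "j \<in> {0, 1}"
  shows "norm (xvec a b c d j) = schmidt_coeff b c d j * norm (yvec a b c d j)"
proof (rule power2_eq_imp_eq)
  show "(norm (xvec a b c d j))\<^sup>2 = (schmidt_coeff b c d j * norm (yvec a b c d j))\<^sup>2"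
    using assms norm_xvec_squared by (auto simp: power_mult_distrib p_def q_def)
qed (simp_all add: schmidt_coeff_nonneg)

text \<open>All factors in the norm formulas are non-zero: \<open>p * q\<close> equals |bcd|^2, the
  roots differ, and neither equals \<open>B\<close>.\<close>

lemma xvec_nonzero: "j \<in> {0, 1} \<Longrightarrow> xvec a b c d j \<noteq> 0"
  and yvec_nonzero: "j \<in> {0, 1} \<Longrightarrow> yvec a b c d j \<noteq> 0"
proof -
  have "p * q \<noteq> 0"
    unfolding p_times_q bcd_eq[symmetric] using nonzero by simp
  then have "norm (xvec a b c d j) \<noteq> 0 \<and> norm (yvec a b c d j) \<noteq> 0" if "j \<in> {0, 1}"
    using that norm_xvec_squared norm_yvec p_neq_q p_neq_B q_neq_B by auto
  then show "j \<in> {0, 1} \<Longrightarrow> xvec a b c d j \<noteq> 0" "j \<in> {0, 1} \<Longrightarrow> yvec a b c d j \<noteq> 0"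
    by auto
qed

text \<open>The first coordinates contribute -|c|^2 A B and the second ones A (p q) = A B |c|^2,
  which cancel.\<close>

lemma xvec_orthogonal: "xvec a b c d 0 \<bottom> xvec a b c d 1"
proof -
  have "cinner (xvec a b c d 0) (xvec a b c d 1) =
      of_real ((cmod c)\<^sup>2 * ((p - B) * (q - B)) + A * (p * q))"
    unfolding cinner_def sum_2 xvec_nth A_def
    by (simp only: of_real_add of_real_mult complex_norm_square complex_cnj_mult
        complex_cnj_minus complex_cnj_cnj complex_cnj_complex_of_real) (simp add: algebra_simps)
  also have "(cmod c)\<^sup>2 * ((p - B) * (q - B)) + A * (p * q) = 0"
    unfolding shifted_prod p_times_q C_eq by (simp add: algebra_simps)
  finally show ?thesis by (simp add: corthogonal_def)
qed

text \<open>The equal first coordinates contribute \<open>A * B\<close>, the second ones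
  \<open>(p - B) * (q - B)\<close>, its negative.\<close>

lemma yvec_orthogonal: "yvec a b c d 0 \<bottom> yvec a b c d 1"
proof -
  have "cinner (yvec a b c d 0) (yvec a b c d 1) =
      of_real ((cmod (cnj a * b * of_real ((cmod d)\<^sup>2)))\<^sup>2 + (p - B) * (q - B))"
    unfolding cinner_def sum_2 yvec_nth
    by (simp only: of_real_add of_real_mult complex_norm_square complex_cnj_mult
        complex_cnj_minus complex_cnj_cnj complex_cnj_complex_of_real) (simp add: algebra_simps)
  then show ?thesis
    by (simp only: norm_yvec_first shifted_prod) (simp add: corthogonal_def)
qed

text \<open>By \<open>norm_xvec\<close> the Schmidt coefficient cancels against the norm of x, so no
  square root survives and each entry is rational in \<open>p\<close> and \<open>q\<close>.\<close>

lemma schmidt_term_nth: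
  assumes "j \<in> {0, 1}"
  shows "(schmidt_coeff b c d j *\<^sub>R ((xvec a b c d j /\<^sub>R norm (xvec a b c d j)) \<otimes>
      (vec_cnj (yvec a b c d j) /\<^sub>R norm (yvec a b c d j)))) $ (k, l) =
    xvec a b c d j $ k * cnj (yvec a b c d j $ l) / of_real ((norm (yvec a b c d j))\<^sup>2)"
proof -
  have "norm (yvec a b c d j) \<noteq> 0" "schmidt_coeff b c d j \<noteq> 0"
    using xvec_nonzero[OF assms] yvec_nonzero[OF assms] norm_xvec[OF assms] by auto
  then show ?thesis
    unfolding norm_xvec[OF assms]
    by (simp add: tensor_def vec_cnj_def scaleR_conv_of_real[where 'a = complex] field_simps
        power2_eq_square)
qed

text \<open>Up to a constant factor, each entry is a divided difference f(p)/(p - q) + f(q)/(q - p).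
  For the entries (1, 1), (1, 2), (2, 1), (2, 2) the function f(t) is 1, t - B, t/(t - B) and t,
  respectively.\<close>

lemma ppE_eq_pp_state: "ppE a b c d = pp_state a b c d"
proof -
  let ?P = "of_real p :: complex" and ?Q = "of_real q :: complex"
    and ?A = "of_real A :: complex" and ?B = "of_real B :: complex"
  have I: "{0..1::nat} = {0, 1}" by auto
  have nth: "ppE a b c d $ (k, l) =
      xvec a b c d 0 $ k * cnj (yvec a b c d 0 $ l) / ((?P - ?B) * (?P - ?Q)) +
      xvec a b c d 1 $ k * cnj (yvec a b c d 1 $ l) / ((?Q - ?B) * (?Q - ?P))" for k l
  proof -
    have "ppE a b c d $ (k, l) = (\<Sum>j\<in>{0, 1}.
        xvec a b c d j $ k * cnj (yvec a b c d j $ l) / of_real ((norm (yvec a b c d j))\<^sup>2))"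
      unfolding ppE_def I sum_component by (intro sum.cong refl schmidt_term_nth)
    also have "\<dots> = xvec a b c d 0 $ k * cnj (yvec a b c d 0 $ l) / of_real ((p - B) * (p - q)) +
        xvec a b c d 1 $ k * cnj (yvec a b c d 1 $ l) / of_real ((q - B) * (q - p))"
      unfolding norm_yvec[symmetric] by simp
    finally show ?thesis by (simp only: of_real_mult of_real_diff)
  qed
  have nz: "?P - ?B \<noteq> 0" "?Q - ?B \<noteq> 0" "?P - ?Q \<noteq> 0" "?Q - ?P \<noteq> 0"
    using p_neq_B q_neq_B p_neq_q by (simp_all flip: of_real_diff)
  have prod: "(?P - ?B) * (?Q - ?B) = - (?A * ?B)"
    using shifted_prod by (metis of_real_diff of_real_minus of_real_mult)
  have nzAB: "?A \<noteq> 0" "?B \<noteq> 0" using A_pos B_pos by simp_all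
  have A: "?A = a * cnj a * of_real ((cmod d)\<^sup>2)"
    by (simp add: A_def norm_mult power_mult_distrib complex_norm_square[symmetric])
  let ?D = "of_real ((cmod d)\<^sup>2) :: complex"
  have e11: "ppE a b c d $ (1, 1) = 0"
  proof -
    have "ppE a b c d $ (1, 1) =
        - (c * a * cnj b * ?D) * (1 / (?P - ?Q) + 1 / (?Q - ?P))"
      unfolding nth xvec_nth yvec_nth using nz by (simp add: distrib_left mult_ac)
    also have "1 / (?P - ?Q) + 1 / (?Q - ?P) = 0" using nz by (simp add: field_simps)
    finally show ?thesis by simp
  qed
  have e12: "ppE a b c d $ (1, 2) = c"
  proof -
    have "ppE a b c d $ (1, 2) = c * ((?P - ?B) / (?P - ?Q) + (?Q - ?B) / (?Q - ?P))"
      unfolding nth xvec_nth yvec_nth using nz by (simp add: distrib_left)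
    also have "(?P - ?B) / (?P - ?Q) + (?Q - ?B) / (?Q - ?P) = 1"
      using nz by (simp add: divide_simps) (simp add: algebra_simps)
    finally show ?thesis by simp
  qed
  have e21: "ppE a b c d $ (2, 1) = d * cnj b"
  proof -
    have "ppE a b c d $ (2, 1) = d * cnj b *
        (?A * (?P / ((?P - ?B) * (?P - ?Q)) + ?Q / ((?Q - ?B) * (?Q - ?P))))"
      unfolding nth xvec_nth yvec_nth A by (simp add: algebra_simps)
    \<comment> \<open>Since t/(t - B) = 1 + B/(t - B), only the divided difference of B/(t - B)
      remains; its denominator is \<open>- (?A * ?B)\<close> by \<open>prod\<close>, so the factor
      \<open>?A\<close> cancels too.\<close>
    also have "?P / ((?P - ?B) * (?P - ?Q)) + ?Q / ((?Q - ?B) * (?Q - ?P)) =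
        - ?B / ((?P - ?B) * (?Q - ?B))"
      using nz by (simp add: divide_simps) (simp add: algebra_simps)
    also have "?A * (- ?B / ((?P - ?B) * (?Q - ?B))) = 1"
      unfolding prod using nzAB by simp
    finally show ?thesis by simp
  qed
  have e22: "ppE a b c d $ (2, 2) = - (d * cnj a)"
  proof -
    have "ppE a b c d $ (2, 2) = - (d * cnj a) * (?P / (?P - ?Q) + ?Q / (?Q - ?P))"
      unfolding nth xvec_nth yvec_nth using nz by (simp add: distrib_left mult_ac)
    also have "?P / (?P - ?Q) + ?Q / (?Q - ?P) = 1"
      using nz by (simp add: divide_simps) (simp add: algebra_simps)
    finally show ?thesis by simp
  qed
  show ?thesis by (simp add: vec_eq_iff_2_times_2 e11 e12 e21 e22)
qed

lemma schmidt_decomposition_ppE: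
  "schmidt_decomposition (ppE a b c d) {0..1} (schmidt_coeff b c d)
     (\<lambda>j. xvec a b c d j /\<^sub>R norm (xvec a b c d j))
     (\<lambda>j. vec_cnj (yvec a b c d j) /\<^sub>R norm (yvec a b c d j))"
proof -
  have "orthonormal_family {0..1} (\<lambda>j. xvec a b c d j /\<^sub>R norm (xvec a b c d j))"
    using xvec_nonzero xvec_orthogonal
    by (intro orthonormal_family_normalized) (auto simp: corthogonal_def)
  moreover have "vec_cnj (yvec a b c d j) \<noteq> 0" if "j \<in> {0, 1}" for j
    using yvec_nonzero[OF that] norm_vec_cnj by (metis norm_eq_zero)
  \<comment> \<open>Conjugation preserves orthogonality. The normalization here is by the norm of
    the conjugated vector, which \<open>norm_vec_cnj\<close> turns into the norm of y.\<close>
  then have "orthonormal_family {0..1}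
      (\<lambda>j. vec_cnj (yvec a b c d j) /\<^sub>R norm (vec_cnj (yvec a b c d j)))"
    using yvec_orthogonal
    by (intro orthonormal_family_normalized) (auto simp: corthogonal_def cinner_vec_cnj)
  ultimately show ?thesis
    by (simp add: schmidt_decomposition_def schmidt_coeff_nonneg ppE_def norm_vec_cnj)
qed

end

theorem proposition12:
  fixes a b :: complex
  assumes "a \<noteq> 0" and "b \<noteq> 0" and "(cmod a)\<^sup>2 + (cmod b)\<^sup>2 = 1"
  shows "product_state (ket0 \<otimes> ket0) \<and>
    product_state (a *s (ket1 \<otimes> ket0) + b *s (ket1 \<otimes> ket1)) \<and>
    {\<psi>. entangled_state \<psi> \<and> \<psi> \<bottom> ket0 \<otimes> ket0 \<and>
         \<psi> \<bottom> a *s (ket1 \<otimes> ket0) + b *s (ket1 \<otimes> ket1)} =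
      {ppE a b c d | c d. c \<noteq> 0 \<and> d \<noteq> 0 \<and> (cmod c)\<^sup>2 + (cmod d)\<^sup>2 = 1} \<and>
    (\<forall>c d. c \<noteq> 0 \<and> d \<noteq> 0 \<and> (cmod c)\<^sup>2 + (cmod d)\<^sup>2 = 1 \<longrightarrow>
      schmidt_decomposition (ppE a b c d) {0..1} (schmidt_coeff b c d)
        (\<lambda>j. xvec a b c d j /\<^sub>R norm (xvec a b c d j))
        (\<lambda>j. vec_cnj (yvec a b c d j) /\<^sub>R norm (yvec a b c d j)) \<and>
      xvec a b c d 0 \<bottom> xvec a b c d 1 \<and>
      yvec a b c d 0 \<bottom> yvec a b c d 1)"
proof (intro conjI)
  have "(norm (ket0 \<otimes> ket0))\<^sup>2 = 1"
    by (simp add: norm_squared_vec_complex sum_2_times_2 tensor_def ket0_def)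
  then show "product_state (ket0 \<otimes> ket0)"
    unfolding product_state_def state_iff_norm_squared by blast
  let ?\<phi> = "a *s (ket1 \<otimes> ket0) + b *s (ket1 \<otimes> ket1)"
  have "(norm ?\<phi>)\<^sup>2 = 1"
    using assms(3)
    by (simp add: norm_squared_vec_complex sum_2_times_2 tensor_def ket0_def ket1_def)
  moreover have "?\<phi> = ket1 \<otimes> (a *s ket0 + b *s ket1)"
    by (simp add: vec_eq_iff_2_times_2 tensor_def ket0_def ket1_def)
  ultimately show "product_state ?\<phi>"
    unfolding product_state_def state_iff_norm_squared by blast
  have params: "pp_params a b c d"
    if "c \<noteq> 0" "d \<noteq> 0" "(cmod c)\<^sup>2 + (cmod d)\<^sup>2 = 1" for c d
    using assms that by unfold_locales
  \<comment> \<open>Orthogonality puts \<psi> in the form \<open>pp_state a b c d\<close>;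
    entanglement then gives precisely the conditions on c and d.\<close>
  have "{\<psi>. entangled_state \<psi> \<and> \<psi> \<bottom> ket0 \<otimes> ket0 \<and> \<psi> \<bottom> ?\<phi>} =
      {pp_state a b c d | c d. c \<noteq> 0 \<and> d \<noteq> 0 \<and> (cmod c)\<^sup>2 + (cmod d)\<^sup>2 = 1}"
    unfolding orthogonal_both_iff[OF assms(2)]
    using entangled_pp_state_iff[OF assms(2,3)] by blast
  \<comment> \<open>The conditions on c and d are those of the locale, so the two families agree
    parameter by parameter.\<close>
  also have "\<dots> = {ppE a b c d | c d. c \<noteq> 0 \<and> d \<noteq> 0 \<and> (cmod c)\<^sup>2 + (cmod d)\<^sup>2 = 1}"
    using pp_params.ppE_eq_pp_state[OF params] by (intro Collect_cong) metis
  finally show "{\<psi>. entangled_state \<psi> \<and> \<psi> \<bottom> ket0 \<otimes> ket0 \<and> \<psi> \<bottom> ?\<phi>} =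
      {ppE a b c d | c d. c \<noteq> 0 \<and> d \<noteq> 0 \<and> (cmod c)\<^sup>2 + (cmod d)\<^sup>2 = 1}" .
  show "\<forall>c d. c \<noteq> 0 \<and> d \<noteq> 0 \<and> (cmod c)\<^sup>2 + (cmod d)\<^sup>2 = 1 \<longrightarrow>
      schmidt_decomposition (ppE a b c d) {0..1} (schmidt_coeff b c d)
        (\<lambda>j. xvec a b c d j /\<^sub>R norm (xvec a b c d j))
        (\<lambda>j. vec_cnj (yvec a b c d j) /\<^sub>R norm (yvec a b c d j)) \<and>
      xvec a b c d 0 \<bottom> xvec a b c d 1 \<and>
      yvec a b c d 0 \<bottom> yvec a b c d 1"
    using params pp_params.schmidt_decomposition_ppE pp_params.xvec_orthogonal
      pp_params.yvec_orthogonal by blast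
qed

end
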